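(* Let $\mathcal{DB}=(\mathcal{D},\mathcal{IC})$ be a database. If $N$ is a $\leq_i$-maximally consistent element in $\mathcal{M}^{\mathcal{DB}}$, then $(\mathrm{Insert}^N,\mathrm{Retract}^N)$ is a $\leq_i$-preferred repair of $\mathcal{DB}$.
   Context: Setting. Fix a first-order language $L$ over a fixed database schema (relation names) and a fixed domain $U$; every element of $U$ has a unique name, quantifiers range over $U$, and equality is identity on $U$. "Atom" means ground atom $P(t)$, with $P$ a relation name and $t$ a tuple over $U$. A database instance is a set of atoms with finite active domain (only finitely many elements of $U$ occur in it). A database is a pair $(\mathcal{D},\mathcal{IC})$ with $\mathcal{D}$ a database instance and $\mathcal{IC}$ (the integrity constraints) a finite set of formulas of $L$. A database to be repaired need not satisfy its integrity constraints. Two-valued semantics. A two-valued valuation assigns $t$ or $f$ to each atom and extends classically to all formulas; a classical (two-valued) model of $\mathcal{IC}$ is such a valuation making all formulas of $\mathcal{IC}$ true. $\mathcal{IC}$ is classically consistent if it has a classical model. For a database instance $\mathcal{D}$, the minimal Herbrand model $\mathcal{H}^{\mathcal{D}}$ assigns $t$ to the atoms in $\mathcal{D}$ and $f$ to all other atoms; $\mathcal{D}\models\mathcal{IC}$ means that $\mathcal{H}^{\mathcal{D}}$ is a model of $\mathcal{IC}$. A database $(\mathcal{D},\mathcal{IC})$ is consistent if $\mathcal{IC}$ is classically consistent and $\mathcal{D}\models\mathcal{IC}$. Repairs. A repair of $(\mathcal{D},\mathcal{IC})$ is a pair $(\mathrm{Insert},\mathrm{Retract})$ of sets of atoms such that (1)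 $\mathrm{Insert}\cap\mathcal{D}=\emptyset$, (2) $\mathrm{Retract}\subseteq\mathcal{D}$, (3) $((\mathcal{D}\cup\mathrm{Insert})\setminus\mathrm{Retract},\mathcal{IC})$ is a consistent database (so, in particular, its first component is a database instance). Set-inclusion preference on repairs: $(I',R')\leq_i(I,R)$ iff $I\subseteq I'$ and $R\subseteq R'$. A repair $(I,R)$ of $\mathcal{DB}$ is $\leq_i$-preferred if for every repair $(I',R')$ of $\mathcal{DB}$, $(I,R)\leq_i(I',R')$ implies $(I',R')\leq_i(I,R)$. Three-valued valuations. The truth values are $t,f,\top$. The order $\leq_k$ has $f<_k\top$ and $t<_k\top$, with $t,f$ incomparable; $\oplus$ is the join for $\leq_k$ (so $x\oplus x=x$, and $x\oplus y=\top$ if $x\neq y$). A three-valued valuation assigns a value in $\{t,f,\top\}$ to each atom. For valuations, $\nu\geq_k\mu$ means $\nu(p)\geq_k\mu(p)$ for every atom $p$, and $(\mathcal{H}^{\mathcal{D}}\oplus M)(p)=\mathcal{H}^{\mathcal{D}}(p)\oplus M(p)$. Write $\nu^{x}=\{p \mid p \text{ an atom},\ \nu(p)=x\}$. Further notation. $\mathrm{Insert}^N=N^{\top}\setminus\mathcal{D}$ and $\mathrm{Retract}^N=N^{\top}\cap\mathcal{D}$. $\mathcal{M}^{\mathcal{DB}}=\{N \mid N \text{ is a three-valued valuation with } N\geq_k\mathcal{H}^{\mathcal{D}}\oplus M \text{ for some classical model } M \text{ of } \mathcal{IC}\}$. An element $N$ of a set $\mathcal{S}$ of three-valued valuations is $\leq_i$-maximally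 consistent in $\mathcal{S}$ if there is no $N'\in\mathcal{S}$ with $N'^{\top}\subsetneq N^{\top}$.
   Formalization: Assumes in addition that N^⊤ has finite active domain (automatic for finite U); without it the claim fails, e.g. U infinite, D = ∅, IC = {∀x P(x)}, where Insert^N is not a database instance. The condition is also necessary for the conclusion. *)

theory Defs
  imports Main
begin

text \<open>
  The domain is the type \<open>'u\<close>. A schema maps the relation names that it contains to their arities.
  Terms are variables or domain elements, so every domain element is its own unique name.
\<close>

type_synonym 'r schema = "'r \<rightharpoonup> nat"

datatype 'u trm = Var nat | Const 'u

datatype ('r, 'u) fm =
    Rel 'r "'u trm list"
  | Eq "'u trm" "'u trm"
  | Neg "('r, 'u) fm"
  | Conj "('r, 'u) fm" "('r, 'u) fm"
  | Disj "('r, 'u) fm" "('r, 'u) fm"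
  | Imp "('r, 'u) fm" "('r, 'u) fm"
  | All nat "('r, 'u) fm"
  | Ex nat "('r, 'u) fm"

fun wf_fm :: "'r schema \<Rightarrow> ('r, 'u) fm \<Rightarrow> bool" where
  "wf_fm sch (Rel P ts) \<longleftrightarrow> sch P = Some (length ts)"
| "wf_fm sch (Eq s t) \<longleftrightarrow> True"
| "wf_fm sch (Neg \<phi>) \<longleftrightarrow> wf_fm sch \<phi>"
| "wf_fm sch (Conj \<phi> \<psi>) \<longleftrightarrow> wf_fm sch \<phi> \<and> wf_fm sch \<psi>"
| "wf_fm sch (Disj \<phi> \<psi>) \<longleftrightarrow> wf_fm sch \<phi> \<and> wf_fm sch \<psi>"
| "wf_fm sch (Imp \<phi> \<psi>) \<longleftrightarrow> wf_fm sch \<phi> \<and> wf_fm sch \<psi>"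
| "wf_fm sch (All x \<phi>) \<longleftrightarrow> wf_fm sch \<phi>"
| "wf_fm sch (Ex x \<phi>) \<longleftrightarrow> wf_fm sch \<phi>"

text \<open>
  The type \<open>atom\<close> also contains pairs with a relation name outside the schema or a tuple of the
  wrong length. Valuations are total functions on this type, but every notion below that inspects
  the value of an atom is restricted to \<open>atoms sch\<close>, the ground atoms of the language.
\<close>

type_synonym ('r, 'u) atom = "'r \<times> 'u list"

definition atoms :: "'r schema \<Rightarrow> ('r, 'u) atom set" where
  "atoms sch = {(P, t). sch P = Some (length t)}"

definition active_domain :: "('r, 'u) atom set \<Rightarrow> 'u set" where
  "active_domain A = (\<Union>(P, t)\<in>A. set t)"

definition is_instance :: "'r schema \<Rightarrow> ('r, 'u) atom set \<Rightarrow> bool" where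
  "is_instance sch D \<longleftrightarrow> D \<subseteq> atoms sch \<and> finite (active_domain D)"

definition is_database :: "'r schema \<Rightarrow> ('r, 'u) atom set \<Rightarrow> ('r, 'u) fm set \<Rightarrow> bool" where
  "is_database sch D IC \<longleftrightarrow> is_instance sch D \<and> finite IC \<and> (\<forall>\<phi>\<in>IC. wf_fm sch \<phi>)"

type_synonym ('r, 'u) val2 = "('r, 'u) atom \<Rightarrow> bool"

fun eval_trm :: "(nat \<Rightarrow> 'u) \<Rightarrow> 'u trm \<Rightarrow> 'u" where
  "eval_trm \<sigma> (Var x) = \<sigma> x"
| "eval_trm \<sigma> (Const c) = c"

fun sat :: "('r, 'u) val2 \<Rightarrow> (nat \<Rightarrow> 'u) \<Rightarrow> ('r, 'u) fm \<Rightarrow> bool" where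
  "sat v \<sigma> (Rel P ts) \<longleftrightarrow> v (P, map (eval_trm \<sigma>) ts)"
| "sat v \<sigma> (Eq s t) \<longleftrightarrow> eval_trm \<sigma> s = eval_trm \<sigma> t"
| "sat v \<sigma> (Neg \<phi>) \<longleftrightarrow> \<not> sat v \<sigma> \<phi>"
| "sat v \<sigma> (Conj \<phi> \<psi>) \<longleftrightarrow> sat v \<sigma> \<phi> \<and> sat v \<sigma> \<psi>"
| "sat v \<sigma> (Disj \<phi> \<psi>) \<longleftrightarrow> sat v \<sigma> \<phi> \<or> sat v \<sigma> \<psi>"
| "sat v \<sigma> (Imp \<phi> \<psi>) \<longleftrightarrow> (sat v \<sigma> \<phi> \<longrightarrow> sat v \<sigma> \<psi>)"
| "sat v \<sigma> (All x \<phi>) \<longleftrightarrow> (\<forall>a. sat v (\<sigma>(x := a)) \<phi>)"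
| "sat v \<sigma> (Ex x \<phi>) \<longleftrightarrow> (\<exists>a. sat v (\<sigma>(x := a)) \<phi>)"

text \<open>Free variables of a constraint are read universally; for sentences \<open>\<sigma>\<close> is irrelevant.\<close>

definition is_model :: "('r, 'u) val2 \<Rightarrow> ('r, 'u) fm set \<Rightarrow> bool" where
  "is_model v IC \<longleftrightarrow> (\<forall>\<phi>\<in>IC. \<forall>\<sigma>. sat v \<sigma> \<phi>)"

definition classically_consistent :: "('r, 'u) fm set \<Rightarrow> bool" where
  "classically_consistent IC \<longleftrightarrow> (\<exists>v. is_model v IC)"

definition herbrand :: "('r, 'u) atom set \<Rightarrow> ('r, 'u) val2" where
  "herbrand D = (\<lambda>p. p \<in> D)"

definition consistent_database ::
    "'r schema \<Rightarrow> ('r, 'u) atom set \<Rightarrow> ('r, 'u) fm set \<Rightarrow> bool" where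
  "consistent_database sch D IC \<longleftrightarrow>
     is_database sch D IC \<and> classically_consistent IC \<and> is_model (herbrand D) IC"

definition is_repair ::
    "'r schema \<Rightarrow> ('r, 'u) atom set \<Rightarrow> ('r, 'u) fm set
      \<Rightarrow> ('r, 'u) atom set \<times> ('r, 'u) atom set \<Rightarrow> bool" where
  "is_repair sch D IC = (\<lambda>(Ins, Ret).
     Ins \<subseteq> atoms sch \<and> Ret \<subseteq> atoms sch \<and> Ins \<inter> D = {} \<and> Ret \<subseteq> D \<and>
     consistent_database sch ((D \<union> Ins) - Ret) IC)"

text \<open>
  \<open>le_i r r'\<close> says that \<open>r'\<close> is at least as preferred as \<open>r\<close>; the larger repair in this order is
  the one that changes fewer atoms.
\<close>

definition le_i :: "'a set \<times> 'a set \<Rightarrow> 'a set \<times> 'a set \<Rightarrow> bool" where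
  "le_i = (\<lambda>(I', R') (I, R). I \<subseteq> I' \<and> R \<subseteq> R')"

definition is_preferred_repair ::
    "'r schema \<Rightarrow> ('r, 'u) atom set \<Rightarrow> ('r, 'u) fm set
      \<Rightarrow> ('r, 'u) atom set \<times> ('r, 'u) atom set \<Rightarrow> bool" where
  "is_preferred_repair sch D IC r \<longleftrightarrow>
     is_repair sch D IC r \<and> (\<forall>r'. is_repair sch D IC r' \<longrightarrow> le_i r r' \<longrightarrow> le_i r' r)"

datatype tv = TT | FF | Both

text \<open>
  The order \<open>\<le>\<close> on \<open>tv\<close> is the knowledge order \<open>\<le>\<^sub>k\<close>, in which \<open>TT\<close> and \<open>FF\<close> are incomparable
  and \<open>Both\<close> (the value \<open>\<top>\<close>) is the top element; \<open>sup\<close> is its join \<open>\<oplus>\<close>.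
\<close>

instantiation tv :: semilattice_sup
begin

definition less_eq_tv :: "tv \<Rightarrow> tv \<Rightarrow> bool" where
  "x \<le> y \<longleftrightarrow> x = y \<or> y = Both"

definition less_tv :: "tv \<Rightarrow> tv \<Rightarrow> bool" where
  "x < y \<longleftrightarrow> x \<noteq> Both \<and> y = Both"

definition sup_tv :: "tv \<Rightarrow> tv \<Rightarrow> tv" where
  "sup x y = (if x = y then x else Both)"

instance
  by standard (auto simp: less_eq_tv_def less_tv_def sup_tv_def split: if_splits)

end

type_synonym ('r, 'u) val3 = "('r, 'u) atom \<Rightarrow> tv"

definition to_val3 :: "('r, 'u) val2 \<Rightarrow> ('r, 'u) val3" where
  "to_val3 v = (\<lambda>p. if v p then TT else FF)"

definition oplus :: "('r, 'u) val3 \<Rightarrow> ('r, 'u) val3 \<Rightarrow> ('r, 'u) val3" where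
  "oplus \<nu> \<mu> = (\<lambda>p. sup (\<nu> p) (\<mu> p))"

definition ge_k :: "'r schema \<Rightarrow> ('r, 'u) val3 \<Rightarrow> ('r, 'u) val3 \<Rightarrow> bool" where
  "ge_k sch \<nu> \<mu> \<longleftrightarrow> (\<forall>p\<in>atoms sch. \<mu> p \<le> \<nu> p)"

definition atoms_with :: "'r schema \<Rightarrow> tv \<Rightarrow> ('r, 'u) val3 \<Rightarrow> ('r, 'u) atom set" where
  "atoms_with sch x \<nu> = {p \<in> atoms sch. \<nu> p = x}"

definition insert_of ::
    "'r schema \<Rightarrow> ('r, 'u) atom set \<Rightarrow> ('r, 'u) val3 \<Rightarrow> ('r, 'u) atom set" where
  "insert_of sch D N = atoms_with sch Both N - D"

definition retract_of ::
    "'r schema \<Rightarrow> ('r, 'u) atom set \<Rightarrow> ('r, 'u) val3 \<Rightarrow> ('r, 'u) atom set" where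
  "retract_of sch D N = atoms_with sch Both N \<inter> D"

text \<open>
  A model \<open>M\<close> may make atoms over infinitely many domain elements true, whereas a repair must
  produce an instance with finite active domain. Over an infinite domain, a maximally consistent
  element of \<open>repair_vals sch D IC\<close> can therefore only induce a repair if its set of atoms with value
  \<open>Both\<close> has finite active domain; the constraint \<open>\<forall>x. P x\<close> with \<open>D = {}\<close> is an example where
  this fails. Over a finite domain the condition always holds.
\<close>

definition repair_vals ::
    "'r schema \<Rightarrow> ('r, 'u) atom set \<Rightarrow> ('r, 'u) fm set \<Rightarrow> ('r, 'u) val3 set" where
  "repair_vals sch D IC =
     {N. \<exists>M. is_model M IC \<and> ge_k sch N (oplus (to_val3 (herbrand D)) (to_val3 M))}"

definition maximally_consistent ::
    "'r schema \<Rightarrow> ('r, 'u) val3 set \<Rightarrow> ('r, 'u) val3 \<Rightarrow> bool" where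
  "maximally_consistent sch S N \<longleftrightarrow>
     N \<in> S \<and> \<not> (\<exists>N'\<in>S. atoms_with sch Both N' \<subset> atoms_with sch Both N)"

end

theory Submission
  imports Defs
begin

text \<open>
  If \<open>M\<close> is a model, \<open>\<H>\<^sup>D \<oplus> M\<close> is inconsistent exactly on the symmetric difference of \<open>D\<close> and \<open>M\<close>.
  Maximal consistency thus forces the inconsistent atoms of \<open>N\<close> to be precisely such a difference,
  so that repairing \<open>D\<close> along them produces \<open>M\<close>. Conversely, every repair yields a model whose
  difference from \<open>D\<close> is the set of repaired atoms, so a strictly better repair would contradict
  maximality.
\<close>

text \<open>Evaluating terms keeps the length of an argument list, so a well-formed formula only
  consults \<open>atoms sch\<close>. A model may be arbitrary on all other pairs, where a Herbrand
  valuation of an instance is false.\<close>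

lemma sat_cong_atoms:
  assumes "wf_fm sch \<phi>" and "\<And>p. p \<in> atoms sch \<Longrightarrow> v p = w p"
  shows "sat v \<sigma> \<phi> = sat w \<sigma> \<phi>"
  using assms(1) by (induction \<phi> arbitrary: \<sigma>) (auto simp: assms(2) atoms_def)

lemma is_model_cong_atoms:
  assumes "\<forall>\<phi>\<in>IC. wf_fm sch \<phi>" and "\<And>p. p \<in> atoms sch \<Longrightarrow> v p = w p"
  shows "is_model v IC = is_model w IC"
  using assms sat_cong_atoms[of sch _ v w] by (simp add: is_model_def)

lemma atoms_with_Both_oplus:
  "atoms_with sch Both (oplus (to_val3 v) (to_val3 w)) = {p \<in> atoms sch. v p \<noteq> w p}"
  by (auto simp: atoms_with_def oplus_def to_val3_def sup_tv_def)

lemma atoms_with_Both_mono: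
  assumes "ge_k sch \<nu> \<mu>"
  shows "atoms_with sch Both \<mu> \<subseteq> atoms_with sch Both \<nu>"
  using assms by (auto simp: ge_k_def atoms_with_def less_eq_tv_def)

lemma oplus_in_repair_vals:
  assumes "is_model M IC"
  shows "oplus (to_val3 (herbrand D)) (to_val3 M) \<in> repair_vals sch D IC"
  using assms by (auto simp: repair_vals_def ge_k_def)

text \<open>The difference set is the \<open>Both\<close> set of a member of
  \<open>repair_vals sch D IC\<close>, so it cannot be strictly smaller. As \<open>M\<close> is any
  model, this serves both the witness for \<open>N\<close> and the models from competing
  repairs.\<close>

lemma maximally_consistent_difference:
  assumes "maximally_consistent sch (repair_vals sch D IC) N" and "is_model M IC"
    and "{p \<in> atoms sch. (p \<in> D) \<noteq> M p} \<subseteq> atoms_with sch Both N"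
  shows "atoms_with sch Both N = {p \<in> atoms sch. (p \<in> D) \<noteq> M p}"
  using assms oplus_in_repair_vals[OF assms(2), of D sch]
    atoms_with_Both_oplus[of sch "herbrand D" M]
  unfolding maximally_consistent_def herbrand_def by (metis psubsetI)

lemma active_domain_mono: "A \<subseteq> B \<Longrightarrow> active_domain A \<subseteq> active_domain B"
  by (auto simp: active_domain_def)

lemma active_domain_Un: "active_domain (A \<union> B) = active_domain A \<union> active_domain B"
  by (auto simp: active_domain_def)

theorem proposition5:
  fixes sch :: "'r schema"
    and D :: "('r, 'u) atom set"
    and IC :: "('r, 'u) fm set"
    and N :: "('r, 'u) val3"
  assumes "is_database sch D IC"
    and "maximally_consistent sch (repair_vals sch D IC) N"
    and "finite (active_domain (atoms_with sch Both N))"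
  shows "is_preferred_repair sch D IC (insert_of sch D N, retract_of sch D N)"
proof -
  let ?B = "atoms_with sch Both N"
  let ?D' = "(D \<union> insert_of sch D N) - retract_of sch D N"
  have D: "D \<subseteq> atoms sch" "finite (active_domain D)"
    and IC: "finite IC" "\<forall>\<phi>\<in>IC. wf_fm sch \<phi>"
    using assms(1) by (auto simp: is_database_def is_instance_def)
  have B: "?B \<subseteq> atoms sch"
    by (auto simp: atoms_with_def)
  obtain M where M: "is_model M IC"
    and ge: "ge_k sch N (oplus (to_val3 (herbrand D)) (to_val3 M))"
    using assms(2) by (auto simp: maximally_consistent_def repair_vals_def)
  have B_eq: "?B = {p \<in> atoms sch. (p \<in> D) \<noteq> M p}"
    using maximally_consistent_difference[OF assms(2) M] atoms_with_Both_mono[OF ge]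
    by (simp add: atoms_with_Both_oplus herbrand_def)
  \<comment> \<open>The repair flips membership in \<open>D\<close> exactly on \<open>?B\<close>,
    where \<open>D\<close> and \<open>M\<close> disagree.\<close>
  have "herbrand ?D' p = M p" if "p \<in> atoms sch" for p
    using that B_eq by (auto simp: herbrand_def insert_of_def retract_of_def)
  then have model: "is_model (herbrand ?D') IC"
    using is_model_cong_atoms[OF IC(2)] M by blast
  \<comment> \<open>Bounds the active domain by two finite ones, although \<open>M\<close> itself
    may be true on infinitely many atoms outside \<open>atoms sch\<close>.\<close>
  have "?D' \<subseteq> D \<union> ?B"
    by (auto simp: insert_of_def)
  then have "finite (active_domain ?D')"
    using active_domain_mono[of ?D' "D \<union> ?B"] D(2) assms(3)
    by (simp add: active_domain_Un finite_subset)
  then have "is_database sch ?D' IC"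
    using D(1) B IC by (auto simp: is_database_def is_instance_def insert_of_def)
  then have repair: "is_repair sch D IC (insert_of sch D N, retract_of sch D N)"
    using B M model
    by (auto simp: is_repair_def consistent_database_def classically_consistent_def
        insert_of_def retract_of_def)
  have "le_i (I', R') (insert_of sch D N, retract_of sch D N)"
    if r: "is_repair sch D IC (I', R')"
      and le: "le_i (insert_of sch D N, retract_of sch D N) (I', R')" for I' R'
  proof -
    let ?D'' = "(D \<union> I') - R'"
    have I': "I' \<subseteq> atoms sch" "I' \<inter> D = {}" and R': "R' \<subseteq> D"
      and model': "is_model (herbrand ?D'') IC"
      using r by (auto simp: is_repair_def consistent_database_def)
    have diff: "{p \<in> atoms sch. (p \<in> D) \<noteq> herbrand ?D'' p} = I' \<union> R'"
      using I' R' D(1) by (auto simp: herbrand_def)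
    have "I' \<union> R' \<subseteq> ?B"
      using le by (auto simp: le_i_def insert_of_def retract_of_def)
    then have "?B = I' \<union> R'"
      using maximally_consistent_difference[OF assms(2) model'] diff by simp
    \<comment> \<open>Splitting \<open>?B\<close> along \<open>D\<close> recovers \<open>I'\<close>
      and \<open>R'\<close>, as \<open>I'\<close> misses \<open>D\<close> and \<open>R'\<close> lies
      in it.\<close>
    then show ?thesis
      using I'(2) R' by (auto simp: le_i_def insert_of_def retract_of_def)
  qed
  with repair show ?thesis
    by (auto simp: is_preferred_repair_def)
qed

end
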